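(* Let $u$ be a weight on $\mathbb{R}^n$ and let $v(x)=|x|^\beta$, where $\beta<-n$. Let $\Phi(t)=t^r(1+\log^+ t)^\delta$ with $r\ge1$ and $\delta\ge0$, and define $w(x)=1/\Phi(v^{-1}(x))$, where $v^{-1}(x)=1/v(x)$. Then there exists a constant $C>0$ such that, for every $t>0$ and every measurable function $f$, $$uw\left(\left\{x\in\mathbb{R}^n:\frac{M_\Phi(fv)(x)}{v(x)}>t\right\}\right)\le C\int_{\mathbb{R}^n}\Phi\left(\frac{|f(x)|v(x)}{t}\right)Mu(x)\,dx.$$
   Context: Cubes $Q\subset\mathbb{R}^n$ have sides parallel to the coordinate axes; $\log^+ t=\max\{\log t,0\}$ (and $\Phi(0)=0$). A weight is a locally integrable function $u$ on $\mathbb{R}^n$ with $0<u(x)<\infty$ for a.e. $x$. For a measurable set $E$, $uw(E)=\int_E u(x)w(x)\,dx$. The generalized maximal operator associated with $\Phi$ is $M_\Phi g(x)=\sup_{Q\ni x}\|g\|_{\Phi,Q}$, the supremum being over cubes $Q$ containing $x$, where $$\|g\|_{\Phi,Q}=\inf\left\{\lambda>0:\frac{1}{|Q|}\int_Q\Phi\left(\frac{|g|}{\lambda}\right)dx\le1\right\}.$$ $M$ is the Hardy-Littlewood maximal operator $Mu(x)=\sup_{Q\ni x}\frac{1}{|Q|}\int_Q|u|\,dy$. *)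

theory Defs
  imports "HOL-Analysis.Analysis"
begin

text \<open>Norms, averages and maximal functions take values in \<^typ>\<open>ennreal\<close>, since each of them may be
  infinite.  Measurability and integrals refer to the completed measure \<^const>\<open>lebesgue\<close>.\<close>

text \<open>Closed, non-degenerate cubes with sides parallel to the coordinate axes.\<close>

definition cubes :: "(real ^ 'n) set set" where
  "cubes = {cbox a (\<chi> i. a $ i + l) | a l. 0 < l}"

text \<open>Being real-valued, a weight is finite everywhere; on null sets its values are arbitrary.\<close>

definition weight :: "(real ^ 'n \<Rightarrow> real) \<Rightarrow> bool" where
  "weight u \<longleftrightarrow>
     (\<forall>K. compact K \<longrightarrow> set_integrable lebesgue K u) \<and> (AE x in lebesgue. 0 < u x)"

definition weighted_measure :: "(real ^ 'n \<Rightarrow> real) \<Rightarrow> (real ^ 'n) set \<Rightarrow> ennreal" where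
  "weighted_measure \<rho> E = (\<integral>\<^sup>+x\<in>E. ennreal (\<rho> x) \<partial>lebesgue)"

definition log_plus :: "real \<Rightarrow> real" where
  "log_plus t = max (ln t) 0"

text \<open>The Luxemburg average; it is infinite if no admissible \<open>c\<close> exists.\<close>

definition luxemburg_average ::
    "(real \<Rightarrow> real) \<Rightarrow> (real ^ 'n) set \<Rightarrow> (real ^ 'n \<Rightarrow> real) \<Rightarrow> ennreal" where
  "luxemburg_average \<Phi> Q g =
     Inf {ennreal c | c. 0 < c \<and>
       (\<integral>\<^sup>+x\<in>Q. ennreal (\<Phi> (\<bar>g x\<bar> / c)) \<partial>lebesgue) / emeasure lebesgue Q \<le> 1}"

definition orlicz_maximal ::
    "(real \<Rightarrow> real) \<Rightarrow> (real ^ 'n \<Rightarrow> real) \<Rightarrow> real ^ 'n \<Rightarrow> ennreal" where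
  "orlicz_maximal \<Phi> g x = (SUP Q\<in>{Q \<in> cubes. x \<in> Q}. luxemburg_average \<Phi> Q g)"

definition hardy_littlewood_maximal :: "(real ^ 'n \<Rightarrow> real) \<Rightarrow> real ^ 'n \<Rightarrow> ennreal" where
  "hardy_littlewood_maximal u x =
     (SUP Q\<in>{Q \<in> cubes. x \<in> Q}. (\<integral>\<^sup>+y\<in>Q. ennreal \<bar>u y\<bar> \<partial>lebesgue) / emeasure lebesgue Q)"

end

theory Submission
  imports Defs
begin

text \<open>
  Write \<open>n\<close> for the dimension, \<open>b = -\<beta> > n\<close>, and \<open>h = \<Phi>(|f| v / t)\<close>.  Because \<open>\<Phi>\<close> is
  submultiplicative, \<open>\<Phi>(|f| v / (t v(x))) \<le> h / w(x)\<close>; so a point \<open>x\<close> of the level set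
  lies in a cube \<open>Q\<close> with \<open>w(x) |Q| \<le> \<integral>\<^sub>Q h\<close>, and the Orlicz maximal operator has been traded for ordinary
  averages of \<open>h\<close> (\<open>orlicz_maximal_gt_imp_large_average\<close>).  What has to be shown is then a mixed weak-type
  inequality for the weight \<open>w(x) = 1/\<Phi>(|x|\<^sup>b)\<close>, and it rests on two properties: \<open>w\<close> is doubling along
  radii, and it decays at least like \<open>|x|\<^sup>-\<^sup>b\<close> with \<open>b > n\<close> (\<open>mixed_weak_type\<close>).

  The points are sorted by the size of their cube \<open>Q\<close>, of side \<open>l\<close>.

  If \<open>l\<close> is small compared with \<open>|x|\<close>, then \<open>w\<close> is at most a multiple of \<open>w(x)\<close> on a fixed dilate of \<open>Q\<close>, and the Vitali covering
  argument for the Fefferman-Stein inequality applies with \<open>w\<close> replaced by its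
  values at the centres of the selected balls (\<open>local_weak_type\<close>).

  If \<open>l\<close> is large, both \<open>|x|\<close> and every \<open>|y|\<close> with \<open>y \<in> Q\<close> are at most a multiple of \<open>l\<close>, so that up to a
  constant \<open>w(x)\<close> is at most one of the Hardy-type averages
  \<open>|x|\<^sup>-\<^sup>n \<integral>\<^bsub>|y| \<le> |x|\<^esub> h(y) dy\<close> and \<open>\<integral>\<^bsub>|y| > |x|\<^esub> h(y) |y|\<^sup>-\<^sup>n dy\<close>
  (\<open>average_over_large_cube\<close>).
  For the second one, Chebyshev's inequality cancels \<open>w\<close>, and Tonelli's theorem leaves \<open>|y|\<^sup>-\<^sup>n \<integral>\<^bsub>|x| < |y|\<^esub> u(x) dx\<close>,
  which is at most a multiple of the average of \<open>u\<close> over a cube containing \<open>y\<close> (\<open>outer_weak_type\<close>).  For the first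
  one, let \<open>x\<^sub>0\<close> be a point almost as close to the origin as possible among those concerned.  The
  \<open>uw\<close>-measure of the complement of the ball of radius \<open>|x\<^sub>0|/2\<close> is summed over dyadic shells: the averages of \<open>u\<close> over
  large cubes around the origin are below \<open>Mu\<close> on the ball of radius \<open>|x\<^sub>0|\<close>, and the \<open>k\<close>-th term carries the
  factor \<open>2\<^bsup>k(n-b)\<^esup>\<close>, which is summable because \<open>b > n\<close> (\<open>inner_weak_type\<close>).

  Since additivity and limit theorems require measurable integrands, \<open>Mu\<close> enters only through averages over explicit
  cubes that bound it from below, and the level set only through measurable supersets.
\<close>

section \<open>Cubes and lower bounds for the maximal function\<close>

lemma cube_obtain_side:
  fixes Q :: "(real ^ 'n) set"
  assumes "Q \<in> cubes"
  obtains l where "0 < l" "Q \<in> sets lebesgue" "emeasure lebesgue Q = ennreal (l ^ CARD('n))"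
    "\<And>x y. x \<in> Q \<Longrightarrow> y \<in> Q \<Longrightarrow> norm (y - x) \<le> real CARD('n) * l"
proof -
  obtain a l where Q: "Q = cbox a (\<chi> i. a $ i + l)" and l: "0 < l"
    using assms by (auto simp: cubes_def)
  have "a \<in> Q" using l by (auto simp: Q mem_box_cart)
  then have "measure lborel Q = l ^ CARD('n)"
    using content_cbox_cart[of a "\<chi> i. a $ i + l"] by (auto simp: Q)
  then have "emeasure lebesgue Q = ennreal (l ^ CARD('n))"
    using emeasure_lborel_cbox_finite[of a "\<chi> i. a $ i + l"]
    by (simp add: Q emeasure_eq_ennreal_measure)
  moreover have "norm (y - x) \<le> real CARD('n) * l" if "x \<in> Q" "y \<in> Q" for x y
  proof -
    have *: "\<bar>(y - x) $ i\<bar> \<le> l" for i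
    proof -
      have "a $ i \<le> x $ i" "x $ i \<le> a $ i + l" "a $ i \<le> y $ i" "y $ i \<le> a $ i + l"
        using that by (auto simp: Q mem_box_cart)
      then show ?thesis by (simp add: abs_le_iff)
    qed
    have "norm (y - x) \<le> (\<Sum>i\<in>UNIV. \<bar>(y - x) $ i\<bar>)" by (rule norm_le_l1_cart)
    also have "\<dots> \<le> real CARD('n) * l"
      using sum_bounded_above[of UNIV "\<lambda>i. \<bar>(y - x) $ i\<bar>" l] * by simp
    finally show ?thesis .
  qed
  ultimately show ?thesis using that[of l] l by (auto simp: Q)
qed

definition central_cube :: "real ^ 'n \<Rightarrow> real \<Rightarrow> (real ^ 'n) set" where
  "central_cube x \<rho> = cbox (\<chi> i. x $ i - \<rho>) (\<chi> i. x $ i + \<rho>)"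

lemma central_cube_in_cubes: "0 < \<rho> \<Longrightarrow> central_cube x \<rho> \<in> cubes"
  unfolding cubes_def central_cube_def
  by (intro CollectI exI[of _ "\<chi> i. x $ i - \<rho>"] exI[of _ "2 * \<rho>"])
     (auto intro!: arg_cong[where f="cbox _"] simp: vec_eq_iff)

lemma cball_subset_central_cube: "cball x \<rho> \<subseteq> central_cube x \<rho>"
proof
  fix y assume "y \<in> cball x \<rho>"
  then have *: "\<bar>(y - x) $ i\<bar> \<le> \<rho>" for i
    using component_le_norm_cart[of "y - x" i] by (simp add: dist_norm norm_minus_commute)
  have "x $ i - \<rho> \<le> y $ i \<and> y $ i \<le> x $ i + \<rho>" for i
    using *[of i] by (simp add: abs_le_iff)
  then show "y \<in> central_cube x \<rho>" by (simp add: central_cube_def mem_box_cart)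
qed

lemma emeasure_central_cube:
  fixes x :: "real ^ 'n"
  assumes "0 < \<rho>"
  shows "emeasure lebesgue (central_cube x \<rho>) = ennreal ((2 * \<rho>) ^ CARD('n))"
proof -
  have "x \<in> central_cube x \<rho>" using assms by (auto simp: central_cube_def mem_box_cart)
  then have "measure lborel (central_cube x \<rho>) = (2 * \<rho>) ^ CARD('n)"
    using content_cbox_cart[of "\<chi> i. x $ i - \<rho>" "\<chi> i. x $ i + \<rho>"]
    by (auto simp: central_cube_def)
  then show ?thesis
    using emeasure_lborel_cbox_finite[of "\<chi> i. x $ i - \<rho>" "\<chi> i. x $ i + \<rho>"]
    by (simp add: central_cube_def emeasure_eq_ennreal_measure)
qed

text \<open>The witness \<open>m\<close> is the average of \<open>|u|\<close> over the cube.  Having one number that bounds the integral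
  from above and \<open>Mu\<close> from below on the whole cube lets it be pulled into integrals of \<open>h\<close>
  over parts of the cube, as a constant.\<close>

lemma integral_le_average_below_maximal:
  fixes x :: "real ^ 'n"
  assumes "0 < \<rho>" "S \<subseteq> central_cube x \<rho>"
  obtains m where "(\<integral>\<^sup>+z\<in>S. ennreal (u z) \<partial>lebesgue) \<le> ennreal ((2 * \<rho>) ^ CARD('n)) * m"
    and "\<And>y. y \<in> central_cube x \<rho> \<Longrightarrow> m \<le> hardy_littlewood_maximal u y"
proof
  let ?P = "central_cube x \<rho>" and ?c = "ennreal ((2 * \<rho>) ^ CARD('n))"
  let ?m = "(\<integral>\<^sup>+z\<in>?P. ennreal \<bar>u z\<bar> \<partial>lebesgue) / emeasure lebesgue ?P"
  have c: "?c \<noteq> 0" "?c \<noteq> top" using assms(1) by auto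
  have "(\<integral>\<^sup>+z\<in>S. ennreal (u z) \<partial>lebesgue) \<le> (\<integral>\<^sup>+z\<in>?P. ennreal \<bar>u z\<bar> \<partial>lebesgue)"
    using assms(2) by (intro nn_integral_mono mult_mono) (auto intro!: ennreal_leI split: split_indicator)
  also have "\<dots> = ?c * ?m"
    using c mult_divide_eq_ennreal[OF c, of "\<integral>\<^sup>+z\<in>?P. ennreal \<bar>u z\<bar> \<partial>lebesgue"]
    by (simp only: emeasure_central_cube[OF assms(1)] ennreal_times_divide mult.commute)
  finally show "(\<integral>\<^sup>+z\<in>S. ennreal (u z) \<partial>lebesgue) \<le> ?c * ?m" .
  show "?m \<le> hardy_littlewood_maximal u y" if "y \<in> ?P" for y
    unfolding hardy_littlewood_maximal_def
    using assms that by (intro SUP_upper) (auto simp: central_cube_in_cubes)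
qed

section \<open>Measure-theoretic preliminaries\<close>

lemma sigma_finite_lebesgue: "sigma_finite_measure (lebesgue :: 'a::euclidean_space measure)"
proof
  have "emeasure lebesgue (cball (0::'a) r) \<noteq> \<infinity>" for r
    using emeasure_lborel_cball_finite[of 0 r] by (simp add: less_top)
  moreover have "(\<Union>n::nat. cball (0::'a) n) = UNIV"
    using real_arch_simple by auto
  ultimately show "\<exists>A::'a set set. countable A \<and> A \<subseteq> sets lebesgue \<and> \<Union> A = space lebesgue
      \<and> (\<forall>a\<in>A. emeasure lebesgue a \<noteq> \<infinity>)"
    by (intro exI[of _ "range (\<lambda>n::nat. cball 0 n)"]) auto
qed

lemma norm_lebesgue_measurable [measurable]:
  "(norm :: 'a::euclidean_space \<Rightarrow> real) \<in> borel_measurable lebesgue"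
proof (rule measurable_completion)
  show "(norm :: 'a \<Rightarrow> real) \<in> borel_measurable lborel"
    using borel_measurable_norm by simp
qed

lemma weighted_measure_eq_emeasure_density:
  assumes "\<rho> \<in> borel_measurable lebesgue" "T \<in> sets lebesgue"
  shows "weighted_measure \<rho> T = emeasure (density lebesgue (\<lambda>x. ennreal (\<rho> x))) T"
  using assms by (simp add: weighted_measure_def emeasure_density)

lemma weighted_measure_mono: "S \<subseteq> T \<Longrightarrow> weighted_measure \<rho> S \<le> weighted_measure \<rho> T"
  unfolding weighted_measure_def by (intro nn_integral_mono mult_left_mono) (auto split: split_indicator)

lemma weighted_measure_Un_le:
  assumes "\<rho> \<in> borel_measurable lebesgue" "S \<in> sets lebesgue" "T \<in> sets lebesgue"
  shows "weighted_measure \<rho> (S \<union> T) \<le> weighted_measure \<rho> S + weighted_measure \<rho> T"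
  using assms
  by (simp add: weighted_measure_eq_emeasure_density emeasure_subadditive sets.Un)

text \<open>For sets that are not known to be measurable, continuity from below has to be replaced: a uniform
  bound on measurable supersets of \<open>E m\<close> is inherited by their limes inferior, which covers the union.\<close>

lemma weighted_measure_le_if_exhausted:
  fixes E :: "nat \<Rightarrow> (real ^ 'n) set"
  assumes \<rho>: "\<rho> \<in> borel_measurable lebesgue" and E: "incseq E" "S \<subseteq> (\<Union>m. E m)"
    and T: "\<And>m. \<exists>T\<in>sets lebesgue. E m \<subseteq> T \<and> weighted_measure \<rho> T \<le> K"
  shows "weighted_measure \<rho> S \<le> K"
proof -
  obtain T where T: "\<And>m. T m \<in> sets lebesgue" "\<And>m. E m \<subseteq> T m" "\<And>m. weighted_measure \<rho> (T m) \<le> K"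
    using T by metis
  define T' where "T' m = (\<Inter>k\<in>{m..}. T k)" for m
  have T'm: "T' m \<in> sets lebesgue" for m unfolding T'_def using T(1) by (intro sets.countable_INT) auto
  have "incseq T'" unfolding T'_def incseq_def by (auto simp: le_trans)
  have "E m \<subseteq> T' m" for m
    using E(1) T(2) unfolding T'_def incseq_def by blast
  then have "(\<Union>m. E m) \<subseteq> (\<Union>m. T' m)" by (intro UN_mono) auto
  then have "S \<subseteq> (\<Union>m. T' m)" using E(2) by (rule order_trans[rotated])
  then have "weighted_measure \<rho> S \<le> weighted_measure \<rho> (\<Union>m. T' m)" by (rule weighted_measure_mono)
  also have "\<dots> = (SUP m. weighted_measure \<rho> (T' m))"
    using T'm \<rho> \<open>incseq T'\<close>
    by (simp add: weighted_measure_eq_emeasure_density SUP_emeasure_incseq image_subset_iff)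
  also have "\<dots> \<le> K"
  proof (rule SUP_least)
    fix m
    have "weighted_measure \<rho> (T' m) \<le> weighted_measure \<rho> (T m)"
      by (rule weighted_measure_mono) (auto simp: T'_def)
    then show "weighted_measure \<rho> (T' m) \<le> K" using T(3)[of m] by simp
  qed
  finally show ?thesis .
qed

text \<open>The measurable minorant \<open>F\<close> makes it possible to pull the constant out of the integral when \<open>f\<close> is
  only known from below, as for \<open>f = h \<cdot> Mu\<close>.\<close>

lemma nn_integral_le_cmult_bound:
  assumes [measurable]: "F \<in> borel_measurable M" and c: "0 < c"
    and le: "\<And>x. F x \<le> ennreal c * f x"
  shows "(\<integral>\<^sup>+x. F x \<partial>M) \<le> ennreal c * (\<integral>\<^sup>+x. f x \<partial>M)"
proof -
  have "F x = ennreal c * (F x / ennreal c)" for x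
    using c by (simp add: ennreal_times_divide mult_divide_eq_ennreal mult.commute[of "ennreal c"])
  then have "(\<integral>\<^sup>+x. F x \<partial>M) = (\<integral>\<^sup>+x. ennreal c * (F x / ennreal c) \<partial>M)" by simp
  also have "\<dots> = ennreal c * (\<integral>\<^sup>+x. F x / ennreal c \<partial>M)"
    by (rule nn_integral_cmult) measurable
  also have "\<dots> \<le> ennreal c * (\<integral>\<^sup>+x. f x \<partial>M)"
    using le c by (intro mult_left_mono nn_integral_mono divide_le_posI_ennreal) (auto simp: mult.commute)
  finally show ?thesis .
qed

section \<open>Points with a small cube\<close>

text \<open>The Fefferman-Stein argument.  Vitali's lemma selects disjoint balls whose fivefold dilates cover \<open>A\<close>.
  The hypothesis that the balls are small compared with the distance to the origin keeps the dilates in the region where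
  \<open>w\<close> is at most \<open>D\<close> times its value at the centre, so each dilate \<open>B x\<close> has \<open>uw\<close>-measure at most a
  multiple of \<open>w(x) \<integral>\<^bsub>B x\<^esub> u\<close>; here \<open>\<integral>\<^bsub>B x\<^esub> u\<close> is at most a multiple of \<open>|Q x| Mu\<close> on \<open>Q x\<close>, and
  \<open>w(x) |Q x|\<close> is paid for by the integral of \<open>h\<close> over the disjoint sets \<open>Q x\<close>.  The bound \<open>R\<close> is there for
  Vitali's lemma, which needs bounded radii.\<close>

lemma local_weak_type:
  fixes u w :: "real ^ 'n \<Rightarrow> real" and h :: "real ^ 'n \<Rightarrow> ennreal"
  assumes [measurable]: "u \<in> borel_measurable lebesgue" "w \<in> borel_measurable lebesgue"
      "h \<in> borel_measurable lebesgue"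
    and w_nonneg: "\<And>x. 0 \<le> w x" and D: "0 \<le> D"
    and doubling: "\<And>x y. x \<noteq> 0 \<Longrightarrow> norm x \<le> 2 * norm y \<Longrightarrow> w y \<le> D * w x"
    and bdd: "\<And>x. x \<in> A \<Longrightarrow> norm x \<le> R"
    and cover: "\<And>x. x \<in> A \<Longrightarrow> \<exists>Q l. Q \<in> sets lebesgue \<and> 0 < l
      \<and> emeasure lebesgue Q = ennreal (l ^ CARD('n)) \<and> Q \<subseteq> cball x (real CARD('n) * l)
      \<and> 10 * (real CARD('n) * l) \<le> norm x
      \<and> ennreal (w x) * emeasure lebesgue Q \<le> (\<integral>\<^sup>+y\<in>Q. h y \<partial>lebesgue)"
  shows "\<exists>T \<in> sets lebesgue. A \<subseteq> T \<and> weighted_measure (\<lambda>x. u x * w x) T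
    \<le> ennreal (D * (10 * real CARD('n)) ^ CARD('n))
       * (\<integral>\<^sup>+x. h x * hardy_littlewood_maximal u x \<partial>lebesgue)"
proof -
  let ?n = "CARD('n)" and ?M = "hardy_littlewood_maximal u"
  \<comment> \<open>\<open>\<kappa>\<close> is the ratio of the volumes of the cube circumscribed to a fivefold ball and of \<open>Q x\<close>.\<close>
  define \<kappa> where "\<kappa> = (10 * real ?n) ^ ?n"
  define good where "good x Q l \<longleftrightarrow> Q \<in> sets lebesgue \<and> 0 < l
      \<and> emeasure lebesgue Q = ennreal (l ^ ?n) \<and> Q \<subseteq> cball x (real ?n * l)
      \<and> 10 * (real ?n * l) \<le> norm x
      \<and> ennreal (w x) * emeasure lebesgue Q \<le> (\<integral>\<^sup>+y\<in>Q. h y \<partial>lebesgue)" for x Q l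
  have "\<forall>x\<in>A. \<exists>Q l. good x Q l"
    using cover unfolding good_def by blast
  then obtain Q l where good: "\<And>x. x \<in> A \<Longrightarrow> good x (Q x) (l x)"
    by metis
  define rad where "rad x = real ?n * l x" for x
  have Qm: "Q x \<in> sets lebesgue" and l: "0 < l x" and rad: "0 < rad x"
    and Qrad: "Q x \<subseteq> cball x (rad x)" and small: "10 * rad x \<le> norm x"
    and avg: "ennreal (w x) * ennreal (l x ^ ?n) \<le> (\<integral>\<^sup>+y\<in>Q x. h y \<partial>lebesgue)"
    if "x \<in> A" for x
    using good[OF that] by (auto simp: rad_def good_def)
  have radR: "0 < rad x \<and> rad x \<le> R" if "x \<in> A" for x
    using rad[OF that] small[OF that] bdd[OF that] by simp
  obtain C where C: "countable C" "C \<subseteq> A"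
      and disj: "pairwise (\<lambda>x y. disjnt (cball x (rad x)) (cball y (rad y))) C"
      and swallow: "\<And>x. x \<in> A \<Longrightarrow> \<exists>y. y \<in> C \<and> \<not> disjnt (cball x (rad x)) (cball y (rad y))
          \<and> cball x (rad x) \<subseteq> ball y (5 * rad y)"
    using Vitali_covering_lemma_cballs_balls[where K = A and a = "\<lambda>x. x" and r = rad and B = R, OF radR]
    by auto
  define B where "B x = ball x (5 * rad x)" for x
  have [measurable]: "B x \<in> sets lebesgue" for x by (simp add: B_def)
  have \<kappa>: "0 < \<kappa>" by (simp add: \<kappa>_def)
  have scale: "(2 * (5 * rad x)) ^ ?n = \<kappa> * l x ^ ?n" for x
    by (simp add: rad_def \<kappa>_def power_mult_distrib)
  have "\<exists>m. (\<integral>\<^sup>+y\<in>B x. ennreal (u y) \<partial>lebesgue) \<le> ennreal (\<kappa> * l x ^ ?n) * m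
      \<and> (\<forall>y\<in>Q x. m \<le> ?M y)" if "x \<in> A" for x
  proof -
    have "B x \<subseteq> central_cube x (5 * rad x)"
      using cball_subset_central_cube ball_subset_cball unfolding B_def by blast
    moreover have "Q x \<subseteq> central_cube x (5 * rad x)"
      using cball_subset_central_cube[of x "5 * rad x"] Qrad[OF that] rad[OF that] by fastforce
    ultimately show ?thesis
      using integral_le_average_below_maximal[of "5 * rad x" "B x" x u] rad[OF that]
      unfolding scale by (metis mult_pos_pos subsetD zero_less_numeral)
  qed
  then obtain c where
    int_le: "\<And>x. x \<in> A \<Longrightarrow>
      (\<integral>\<^sup>+y\<in>B x. ennreal (u y) \<partial>lebesgue) \<le> ennreal (\<kappa> * l x ^ ?n) * c x"
    and c_le: "\<And>x y. x \<in> A \<Longrightarrow> y \<in> Q x \<Longrightarrow> c x \<le> ?M y"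
    by metis
  have ball_est: "(\<integral>\<^sup>+y. ennreal (u y * w y) * indicator (B x) y \<partial>lebesgue)
      \<le> ennreal (D * \<kappa>) * (\<integral>\<^sup>+y. c x * (h y * indicator (Q x) y) \<partial>lebesgue)" if "x \<in> C" for x
  proof -
    have "x \<in> A" using that C by auto
    then have [measurable]: "Q x \<in> sets lebesgue" using Qm by auto
    have "x \<noteq> 0" using rad[OF \<open>x \<in> A\<close>] small[OF \<open>x \<in> A\<close>] by auto
    have far: "norm x \<le> 2 * norm y" if "y \<in> B x" for y
    proof -
      have "norm (x - y) \<le> norm x / 2"
        using that small[OF \<open>x \<in> A\<close>] by (auto simp: B_def dist_norm)
      then show ?thesis using norm_triangle_ineq2[of x y] by simp
    qed
    have "(\<integral>\<^sup>+y. ennreal (u y * w y) * indicator (B x) y \<partial>lebesgue)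
        \<le> (\<integral>\<^sup>+y. ennreal (D * w x) * (ennreal (u y) * indicator (B x) y) \<partial>lebesgue)"
    proof (intro nn_integral_mono)
      fix y
      show "ennreal (u y * w y) * indicator (B x) y \<le> ennreal (D * w x) * (ennreal (u y) * indicator (B x) y)"
      proof (cases "y \<in> B x")
        case True
        then have "ennreal (w y) \<le> ennreal (D * w x)"
          using doubling[OF \<open>x \<noteq> 0\<close> far] by (auto intro: ennreal_leI)
        then have "ennreal (u y) * ennreal (w y) \<le> ennreal (u y) * ennreal (D * w x)"
          by (rule mult_left_mono) simp
        then show ?thesis using True by (simp add: ennreal_mult''[OF w_nonneg] mult.commute)
      qed simp
    qed
    also have "\<dots> = ennreal (D * w x) * (\<integral>\<^sup>+y\<in>B x. ennreal (u y) \<partial>lebesgue)"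
      by (rule nn_integral_cmult) measurable
    also have "\<dots> \<le> ennreal (D * w x) * (ennreal (\<kappa> * l x ^ ?n) * c x)"
      by (intro mult_left_mono int_le \<open>x \<in> A\<close>) simp
    also have "\<dots> = ennreal (D * \<kappa>) * (c x * (ennreal (w x) * ennreal (l x ^ ?n)))"
      using D \<kappa> w_nonneg[of x] l[OF \<open>x \<in> A\<close>]
      by (simp add: ennreal_mult mult_ac)
    also have "\<dots> \<le> ennreal (D * \<kappa>) * (c x * (\<integral>\<^sup>+y\<in>Q x. h y \<partial>lebesgue))"
      by (intro mult_left_mono avg \<open>x \<in> A\<close>) auto
    also have "c x * (\<integral>\<^sup>+y\<in>Q x. h y \<partial>lebesgue) = (\<integral>\<^sup>+y. c x * (h y * indicator (Q x) y) \<partial>lebesgue)"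
      by (rule nn_integral_cmult[symmetric]) measurable
    finally show ?thesis .
  qed
  have disjQ: "x = x'" if "x \<in> C" "x' \<in> C" "y \<in> Q x" "y \<in> Q x'" for x x' y
  proof (rule ccontr)
    assume "x \<noteq> x'"
    then have "disjnt (cball x (rad x)) (cball x' (rad x'))"
      using disj that unfolding pairwise_def by blast
    moreover have "y \<in> cball x (rad x)" "y \<in> cball x' (rad x')"
      using that Qrad C(2) by blast+
    ultimately show False unfolding disjnt_iff by blast
  qed
  have pointwise: "(\<integral>\<^sup>+x. c x * (h y * indicator (Q x) y) \<partial>count_space C) \<le> h y * ?M y" for y
  proof (cases "\<exists>x\<in>C. y \<in> Q x")
    case True
    then obtain x0 where x0: "x0 \<in> C" "y \<in> Q x0" by auto
    have "(\<integral>\<^sup>+x. c x * (h y * indicator (Q x) y) \<partial>count_space C)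
        = (\<integral>\<^sup>+x. (c x0 * h y) * indicator {x0} x \<partial>count_space C)"
    proof (rule nn_integral_cong)
      fix x assume "x \<in> space (count_space C)"
      then have "y \<in> Q x \<longleftrightarrow> x = x0" using disjQ[of x x0 y] x0 by auto
      then show "c x * (h y * indicator (Q x) y) = (c x0 * h y) * indicator {x0} x"
        by (auto simp: indicator_def)
    qed
    also have "\<dots> = c x0 * h y"
      using x0 by (subst nn_integral_cmult_indicator) auto
    also have "\<dots> \<le> h y * ?M y"
      using c_le[OF subsetD[OF C(2) x0(1)] x0(2)] by (metis mult.commute mult_left_mono zero_le)
    finally show ?thesis .
  next
    case False
    then have "(\<integral>\<^sup>+x. c x * (h y * indicator (Q x) y) \<partial>count_space C) = (\<integral>\<^sup>+x. 0 \<partial>count_space C)"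
      by (intro nn_integral_cong) auto
    then show ?thesis by simp
  qed
  define T where "T = (\<Union>x\<in>C. B x)"
  have "A \<subseteq> T"
  proof
    fix x assume "x \<in> A"
    then obtain y where "y \<in> C" "cball x (rad x) \<subseteq> ball y (5 * rad y)" using swallow by blast
    then show "x \<in> T" using radR[OF \<open>x \<in> A\<close>] by (force simp: T_def B_def)
  qed
  moreover have "T \<in> sets lebesgue" unfolding T_def using C(1) by auto
  moreover have "weighted_measure (\<lambda>x. u x * w x) T
      \<le> ennreal (D * \<kappa>) * (\<integral>\<^sup>+x. h x * ?M x \<partial>lebesgue)"
  proof -
    have "weighted_measure (\<lambda>x. u x * w x) T
        \<le> (\<integral>\<^sup>+y. \<integral>\<^sup>+x. ennreal (u y * w y) * indicator (B x) y \<partial>count_space C \<partial>lebesgue)"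
      unfolding weighted_measure_def
    proof (intro nn_integral_mono)
      fix y
      show "ennreal (u y * w y) * indicator T y
          \<le> (\<integral>\<^sup>+x. ennreal (u y * w y) * indicator (B x) y \<partial>count_space C)"
      proof (cases "y \<in> T")
        case True
        then obtain x where x: "x \<in> C" "y \<in> B x" by (auto simp: T_def)
        have "ennreal (u y * w y) = (\<integral>\<^sup>+x'. ennreal (u y * w y) * indicator {x} x' \<partial>count_space C)"
          using x by (subst nn_integral_cmult_indicator) auto
        also have "\<dots> \<le> (\<integral>\<^sup>+x. ennreal (u y * w y) * indicator (B x) y \<partial>count_space C)"
          using x by (intro nn_integral_mono) (auto split: split_indicator)
        finally show ?thesis using True by simp
      qed simp
    qed
    also have "\<dots> = (\<integral>\<^sup>+x. \<integral>\<^sup>+y. ennreal (u y * w y) * indicator (B x) y \<partial>lebesgue \<partial>count_space C)"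
      by (rule nn_integral_count_space_nn_integral[OF C(1)]) measurable
    also have "\<dots> \<le> (\<integral>\<^sup>+x. ennreal (D * \<kappa>) * (\<integral>\<^sup>+y. c x * (h y * indicator (Q x) y) \<partial>lebesgue) \<partial>count_space C)"
      by (intro nn_integral_mono ball_est) simp
    also have "\<dots> = ennreal (D * \<kappa>) * (\<integral>\<^sup>+x. \<integral>\<^sup>+y. c x * (h y * indicator (Q x) y) \<partial>lebesgue \<partial>count_space C)"
      by (rule nn_integral_cmult) simp
    also have "(\<integral>\<^sup>+x. \<integral>\<^sup>+y. c x * (h y * indicator (Q x) y) \<partial>lebesgue \<partial>count_space C)
        = (\<integral>\<^sup>+y. \<integral>\<^sup>+x. c x * (h y * indicator (Q x) y) \<partial>count_space C \<partial>lebesgue)"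
    proof (rule nn_integral_count_space_nn_integral[OF C(1), symmetric])
      fix x assume "x \<in> C"
      then have [measurable]: "Q x \<in> sets lebesgue" using Qm C by auto
      show "(\<lambda>y. c x * (h y * indicator (Q x) y)) \<in> borel_measurable lebesgue" by measurable
    qed
    also have "ennreal (D * \<kappa>) * \<dots> \<le> ennreal (D * \<kappa>) * (\<integral>\<^sup>+y. h y * ?M y \<partial>lebesgue)"
      by (intro mult_left_mono nn_integral_mono pointwise) simp
    finally show ?thesis .
  qed
  ultimately show ?thesis unfolding \<kappa>_def by blast
qed

section \<open>The outer Hardy average\<close>

text \<open>On the set in question \<open>uw \<le> K u G\<close>, so the weight \<open>w\<close> disappears; exchanging the order of integration
  turns the kernel of \<open>G\<close> into an average of \<open>u\<close> over the ball of radius \<open>|y|\<close> around the origin.\<close>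

lemma outer_weak_type:
  fixes u w :: "real ^ 'n \<Rightarrow> real" and h :: "real ^ 'n \<Rightarrow> ennreal"
  assumes [measurable]: "u \<in> borel_measurable lebesgue" "w \<in> borel_measurable lebesgue"
      "h \<in> borel_measurable lebesgue"
    and w_nonneg: "\<And>x. 0 \<le> w x"
    and G: "\<And>x. G x = (\<integral>\<^sup>+y. h y / ennreal (norm y ^ CARD('n)) * indicator {y. norm x < norm y} y \<partial>lebesgue)"
  shows "{x. ennreal (w x) \<le> K * G x} \<in> sets lebesgue"
    and "weighted_measure (\<lambda>x. u x * w x) {x. ennreal (w x) \<le> K * G x}
      \<le> K * ennreal (2 ^ CARD('n)) * (\<integral>\<^sup>+x. h x * hardy_littlewood_maximal u x \<partial>lebesgue)"
proof -
  let ?n = "CARD('n)" and ?M = "hardy_littlewood_maximal u"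
  interpret sigma_finite_measure "lebesgue :: (real ^ 'n) measure" by (rule sigma_finite_lebesgue)
  interpret P: pair_sigma_finite "lebesgue :: (real ^ 'n) measure" "lebesgue :: (real ^ 'n) measure" ..
  have ind: "indicator {y. norm x < norm y} y = (if norm x < norm y then 1 else 0::ennreal)" for x y :: "real ^ 'n"
    by (auto split: split_indicator)
  have [measurable]: "G \<in> borel_measurable lebesgue"
    unfolding G ind by measurable
  show "{x. ennreal (w x) \<le> K * G x} \<in> sets lebesgue"
  proof -
    have "{x \<in> space lebesgue. ennreal (w x) \<le> K * G x} \<in> sets lebesgue" by measurable
    then show ?thesis by simp
  qed
  let ?k = "\<lambda>x y. ennreal (u x) * (h y / ennreal (norm y ^ ?n) * indicator {y. norm x < norm y} y)"
  have "weighted_measure (\<lambda>x. u x * w x) {x. ennreal (w x) \<le> K * G x}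
      \<le> (\<integral>\<^sup>+x. K * (ennreal (u x) * G x) \<partial>lebesgue)"
    unfolding weighted_measure_def
  proof (intro nn_integral_mono)
    fix x
    show "ennreal (u x * w x) * indicator {x. ennreal (w x) \<le> K * G x} x \<le> K * (ennreal (u x) * G x)"
      using mult_left_mono[of "ennreal (w x)" "K * G x" "ennreal (u x)"]
      by (auto simp: ennreal_mult''[OF w_nonneg] mult_ac split: split_indicator)
  qed
  also have "\<dots> = K * (\<integral>\<^sup>+x. ennreal (u x) * G x \<partial>lebesgue)"
    by (rule nn_integral_cmult) measurable
  also have "(\<integral>\<^sup>+x. ennreal (u x) * G x \<partial>lebesgue) = (\<integral>\<^sup>+x. \<integral>\<^sup>+y. ?k x y \<partial>lebesgue \<partial>lebesgue)"
    unfolding G ind by (intro nn_integral_cong nn_integral_cmult[symmetric]) measurable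
  also have "\<dots> = (\<integral>\<^sup>+y. \<integral>\<^sup>+x. ?k x y \<partial>lebesgue \<partial>lebesgue)"
    unfolding ind by (rule P.Fubini'[symmetric]) measurable
  also have "\<dots> \<le> ennreal (2 ^ ?n) * (\<integral>\<^sup>+y. h y * ?M y \<partial>lebesgue)"
  proof (rule nn_integral_le_cmult_bound)
    show "(\<lambda>y. \<integral>\<^sup>+x. ?k x y \<partial>lebesgue) \<in> borel_measurable lebesgue"
      unfolding ind by measurable
  next
    fix y :: "real ^ 'n"
    show "(\<integral>\<^sup>+x. ?k x y \<partial>lebesgue) \<le> ennreal (2 ^ ?n) * (h y * ?M y)"
    proof (cases "y = 0")
      case False
      then have pos: "0 < norm y" by simp
      have "ball 0 (norm y) \<subseteq> central_cube 0 (norm y)"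
        using cball_subset_central_cube ball_subset_cball by blast
      from integral_le_average_below_maximal[OF pos this, of u] obtain m
        where m: "(\<integral>\<^sup>+z\<in>ball 0 (norm y). ennreal (u z) \<partial>lebesgue) \<le> ennreal ((2 * norm y) ^ ?n) * m"
          and "\<And>z. z \<in> central_cube 0 (norm y) \<Longrightarrow> m \<le> ?M z" by blast
      moreover have "y \<in> central_cube 0 (norm y)"
        using cball_subset_central_cube[of 0 "norm y"] by auto
      ultimately have "m \<le> ?M y" by blast
      have [measurable]: "ball 0 (norm y) \<in> sets (lebesgue :: (real ^ 'n) measure)" by simp
      have "(\<integral>\<^sup>+x. ?k x y \<partial>lebesgue)
          = (\<integral>\<^sup>+x. h y / ennreal (norm y ^ ?n) * (ennreal (u x) * indicator (ball 0 (norm y)) x) \<partial>lebesgue)"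
        by (intro nn_integral_cong) (auto simp: mult_ac split: split_indicator)
      also have "\<dots> = h y / ennreal (norm y ^ ?n) * (\<integral>\<^sup>+x\<in>ball 0 (norm y). ennreal (u x) \<partial>lebesgue)"
        by (rule nn_integral_cmult) measurable
      also have "\<dots> \<le> h y / ennreal (norm y ^ ?n) * (ennreal ((2 * norm y) ^ ?n) * ?M y)"
        using m mult_left_mono[OF \<open>m \<le> ?M y\<close>, of "ennreal ((2 * norm y) ^ ?n)"]
        by (intro mult_left_mono) (auto intro: order_trans)
      also have "\<dots> = (h y / ennreal (norm y ^ ?n) * ennreal (norm y ^ ?n)) * (ennreal (2 ^ ?n) * ?M y)"
        by (simp add: power_mult_distrib ennreal_mult mult_ac)
      also have "h y / ennreal (norm y ^ ?n) * ennreal (norm y ^ ?n) = h y"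
        using pos by (simp add: ennreal_divide_times)
      finally show ?thesis by (simp add: mult_ac)
    qed simp
  qed simp
  finally show "weighted_measure (\<lambda>x. u x * w x) {x. ennreal (w x) \<le> K * G x}
      \<le> K * ennreal (2 ^ ?n) * (\<integral>\<^sup>+x. h x * ?M x \<partial>lebesgue)"
    by (simp add: mult.assoc mult_left_mono)
qed

section \<open>The inner Hardy average\<close>

text \<open>The exterior region is cut into the dyadic shells \<open>S k\<close>.  On \<open>S k\<close> the weight is at most
  \<open>D 2\<^bsup>-kb\<^esup> w(x\<^sub>0)\<close>, while \<open>\<integral> u\<close> over \<open>S k\<close> is at most \<open>2\<^bsup>kn\<^esup> |2x\<^sub>0|\<^sup>n\<close> times an average of \<open>u\<close> that is below
  \<open>Mu\<close> on the ball of radius \<open>|x\<^sub>0|\<close>.  The factor \<open>w(x\<^sub>0) |x\<^sub>0|\<^sup>n\<close> is bounded by the integral of \<open>h\<close> over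
  that same ball, and the remaining geometric series converges since \<open>b > n\<close>.\<close>

lemma inner_weak_type:
  fixes u w :: "real ^ 'n \<Rightarrow> real" and h :: "real ^ 'n \<Rightarrow> ennreal"
  assumes [measurable]: "u \<in> borel_measurable lebesgue" "w \<in> borel_measurable lebesgue"
      "h \<in> borel_measurable lebesgue"
    and w_nonneg: "\<And>x. 0 \<le> w x" and D: "0 \<le> D"
    and doubling: "\<And>x y. x \<noteq> 0 \<Longrightarrow> norm x \<le> 2 * norm y \<Longrightarrow> w y \<le> D * w x"
    and decay: "\<And>x y c. x \<noteq> 0 \<Longrightarrow> 1 \<le> c \<Longrightarrow> c * norm x \<le> norm y \<Longrightarrow> c powr b * w y \<le> w x"
    and b: "real CARD('n) < b"
    and "x0 \<noteq> 0"
    and large: "ennreal (w x0 * norm x0 ^ CARD('n)) \<le> K * (\<integral>\<^sup>+y\<in>cball 0 (norm x0). h y \<partial>lebesgue)"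
  shows "weighted_measure (\<lambda>x. u x * w x) {x. norm x0 \<le> 2 * norm x}
    \<le> ennreal (D * 2 ^ CARD('n) / (1 - 2 powr (real CARD('n) - b))) * K
       * (\<integral>\<^sup>+x. h x * hardy_littlewood_maximal u x \<partial>lebesgue)"
proof -
  let ?n = "CARD('n)" and ?M = "hardy_littlewood_maximal u"
  define s where "s = norm x0"
  define q where "q = 2 powr (real ?n - b)"
  have s: "0 < s" using \<open>x0 \<noteq> 0\<close> by (simp add: s_def)
  have q: "0 < q" "q < 1" using b by (auto simp: q_def powr_less_one)
  define S where "S k = {x :: real ^ 'n. 2 ^ k * s \<le> 2 * norm x \<and> norm x \<le> 2 ^ k * s}" for k :: nat
  have S_meas [measurable]: "S k \<in> sets lebesgue" for k
  proof -
    have "{x \<in> space lebesgue. 2 ^ k * s \<le> 2 * norm (x :: real ^ 'n) \<and> norm x \<le> 2 ^ k * s} \<in> sets lebesgue"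
      by measurable
    then show ?thesis by (simp add: S_def)
  qed
  have shells: "{x. norm x0 \<le> 2 * norm x} \<subseteq> (\<Union>k. S k)"
  proof
    fix x :: "real ^ 'n" assume "x \<in> {x. norm x0 \<le> 2 * norm x}"
    then have x: "s \<le> 2 * norm x" by (simp add: s_def)
    define k where "k = (LEAST k::nat. norm x \<le> 2 ^ k * s)"
    obtain j :: nat where "norm x / s < 2 ^ j" using real_arch_pow[of 2 "norm x / s"] by auto
    then have "norm x \<le> 2 ^ j * s" using s by (simp add: field_simps)
    then have up: "norm x \<le> 2 ^ k * s" unfolding k_def by (rule LeastI)
    have "2 ^ k * s \<le> 2 * norm x"
    proof (cases k)
      case (Suc i)
      then have "\<not> norm x \<le> 2 ^ i * s" using not_less_Least[of i "\<lambda>k. norm x \<le> 2 ^ k * s"] by (simp add: k_def)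
      then show ?thesis using Suc by simp
    qed (use x in simp)
    with up show "x \<in> (\<Union>k. S k)" by (auto simp: S_def)
  qed
  have w_shell: "w y \<le> D * (2 powr - b) ^ k * w x0" if "y \<in> S k" for y k
  proof -
    \<comment> \<open>The inner radius of the shell \<open>S 0\<close> is \<open>s/2\<close>: decay starts from \<open>x\<^sub>0/2\<close>, and doubling leads back to \<open>x\<^sub>0\<close>.\<close>
    have "2 ^ k * norm ((1/2) *\<^sub>R x0) \<le> norm y"
      using that by (simp add: S_def s_def)
    from decay[OF _ _ this] \<open>x0 \<noteq> 0\<close>
    have "(2 ^ k) powr b * w y \<le> w ((1/2) *\<^sub>R x0)" by simp
    also have "\<dots> \<le> D * w x0" using doubling[OF \<open>x0 \<noteq> 0\<close>, of "(1/2) *\<^sub>R x0"] by simp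
    finally have le: "(2 ^ k) powr b * w y \<le> D * w x0" .
    have "(2 ^ k) powr b = (2 powr b) ^ k"
      by (simp add: powr_realpow[symmetric] powr_powr mult.commute)
    then have "((2::real) powr - b) ^ k * (2 ^ k) powr b = 1"
      by (simp add: power_mult_distrib[symmetric] powr_minus)
    then have "w y = (2 powr - b) ^ k * ((2 ^ k) powr b * w y)"
      by (metis mult.assoc mult_1)
    also have "\<dots> \<le> (2 powr - b) ^ k * (D * w x0)"
      by (intro mult_left_mono le) simp
    finally show ?thesis by (simp add: mult_ac)
  qed
  let ?I = "\<integral>\<^sup>+y. h y * ?M y \<partial>lebesgue"
  have shell: "weighted_measure (\<lambda>x. u x * w x) (S k) \<le> ennreal (q ^ k) * (ennreal (D * 2 ^ ?n) * K * ?I)" for k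
  proof -
    have [measurable]: "cball 0 s \<in> sets (lebesgue :: (real ^ 'n) measure)" by simp
    let ?\<rho> = "2 ^ k * s" and ?a = "D * (2 powr - b) ^ k * w x0"
    have \<rho>: "0 < ?\<rho>" using s by simp
    have "S k \<subseteq> central_cube 0 ?\<rho>"
      using cball_subset_central_cube[of 0 ?\<rho>] by (auto simp: S_def)
    from integral_le_average_below_maximal[OF \<rho> this, of u] obtain m
      where m: "(\<integral>\<^sup>+z\<in>S k. ennreal (u z) \<partial>lebesgue) \<le> ennreal ((2 * ?\<rho>) ^ ?n) * m"
        and below: "\<And>z. z \<in> central_cube 0 ?\<rho> \<Longrightarrow> m \<le> ?M z" by blast
    have "s \<le> ?\<rho>" using s by simp
    then have below: "m \<le> ?M z" if "z \<in> cball 0 s" for z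
    proof -
      have "z \<in> cball 0 ?\<rho>" using that \<open>s \<le> ?\<rho>\<close> by simp
      then show ?thesis using below cball_subset_central_cube by blast
    qed
    have "weighted_measure (\<lambda>x. u x * w x) (S k)
        \<le> (\<integral>\<^sup>+x. ennreal ?a * (ennreal (u x) * indicator (S k) x) \<partial>lebesgue)"
      unfolding weighted_measure_def
    proof (intro nn_integral_mono)
      fix x
      show "ennreal (u x * w x) * indicator (S k) x \<le> ennreal ?a * (ennreal (u x) * indicator (S k) x)"
      proof (cases "x \<in> S k")
        case True
        have "ennreal (u x) * ennreal (w x) \<le> ennreal (u x) * ennreal ?a"
          using w_shell[OF True] by (intro mult_left_mono ennreal_leI) auto
        then show ?thesis using True by (simp add: ennreal_mult''[OF w_nonneg] mult.commute)
      qed simp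
    qed
    also have "\<dots> = ennreal ?a * (\<integral>\<^sup>+x\<in>S k. ennreal (u x) \<partial>lebesgue)"
      by (rule nn_integral_cmult) measurable
    also have "\<dots> \<le> ennreal ?a * (ennreal ((2 * ?\<rho>) ^ ?n) * m)"
      by (intro mult_left_mono m) simp
    also have "\<dots> = ennreal (?a * (2 * ?\<rho>) ^ ?n) * m"
      using D w_nonneg s by (simp add: ennreal_mult mult.assoc)
    also have "?a * (2 * ?\<rho>) ^ ?n = q ^ k * (D * 2 ^ ?n) * (w x0 * s ^ ?n)"
    proof -
      have "(2 powr - b) ^ k * (2 ^ k) ^ ?n = q ^ k"
      proof -
        have "(2 ^ k) ^ ?n = ((2::real) powr real ?n) ^ k"
          by (simp add: powr_realpow mult.commute flip: power_mult)
        then show ?thesis by (simp add: q_def power_mult_distrib[symmetric] powr_add[symmetric])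
      qed
      then show ?thesis by (simp add: power_mult_distrib mult_ac)
    qed
    also have "ennreal (q ^ k * (D * 2 ^ ?n) * (w x0 * s ^ ?n)) * m
        = ennreal (q ^ k) * (ennreal (D * 2 ^ ?n) * (ennreal (w x0 * s ^ ?n) * m))"
      using q D w_nonneg s by (simp add: ennreal_mult mult.assoc)
    also have "ennreal (w x0 * s ^ ?n) * m \<le> K * (\<integral>\<^sup>+y\<in>cball 0 s. h y \<partial>lebesgue) * m"
      using large by (intro mult_right_mono) (auto simp: s_def)
    also have "\<dots> = K * (\<integral>\<^sup>+y. h y * indicator (cball 0 s) y * m \<partial>lebesgue)"
      by (subst nn_integral_multc) (auto simp: mult.assoc)
    also have "\<dots> \<le> K * ?I"
      using below by (intro mult_left_mono nn_integral_mono) (auto split: split_indicator intro: mult_left_mono)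
    finally show ?thesis by (simp add: mult.assoc mult_left_mono)
  qed
  have "weighted_measure (\<lambda>x. u x * w x) {x. norm x0 \<le> 2 * norm x}
      \<le> weighted_measure (\<lambda>x. u x * w x) (\<Union>k. S k)"
    by (rule weighted_measure_mono[OF shells])
  also have "\<dots> \<le> (\<Sum>k. weighted_measure (\<lambda>x. u x * w x) (S k))"
    using emeasure_subadditive_countably[of S "density lebesgue (\<lambda>x. ennreal (u x * w x))"]
    by (simp add: weighted_measure_eq_emeasure_density image_subset_iff)
  also have "\<dots> \<le> (\<Sum>k. ennreal (q ^ k) * (ennreal (D * 2 ^ ?n) * K * ?I))"
    by (intro suminf_le shell) auto
  also have "\<dots> = (\<Sum>k. ennreal (q ^ k)) * (ennreal (D * 2 ^ ?n) * K * ?I)"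
    by simp
  also have "(\<Sum>k. ennreal (q ^ k)) = ennreal (1 / (1 - q))"
    using q geometric_sums[of q] by (intro suminf_ennreal_eq) auto
  also have "ennreal (1 / (1 - q)) * (ennreal (D * 2 ^ ?n) * K * ?I)
      = ennreal (D * 2 ^ ?n / (1 - q)) * K * ?I"
  proof -
    have "ennreal (D * 2 ^ ?n / (1 - q)) = ennreal (1 / (1 - q)) * ennreal (D * 2 ^ ?n)"
      using q D by (subst ennreal_mult[symmetric]) auto
    then show ?thesis by (simp add: mult.assoc)
  qed
  finally show ?thesis by (simp add: q_def)
qed

section \<open>The mixed weak-type inequality for radially decaying weights\<close>

text \<open>Here \<open>\<omega>\<close> is the value of the weight at \<open>x\<close>.  All points of \<open>Q\<close>, and \<open>x\<close> itself, have norm at most \<open>11nl\<close>,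
  so \<open>1/|Q|\<close> is at most a constant times \<open>max(|x|, |y|)\<^sup>-\<^sup>n\<close> for \<open>y \<in> Q\<close>; splitting at \<open>|y| = |x|\<close> gives two terms, the
  larger of which is at least half of their sum.\<close>

lemma average_over_large_cube:
  fixes h :: "real ^ 'n \<Rightarrow> ennreal"
    and \<omega> :: real
  assumes [measurable]: "h \<in> borel_measurable lebesgue"
    and Q: "Q \<in> sets lebesgue" "Q \<subseteq> cball x (real CARD('n) * l)" "norm x < 10 * (real CARD('n) * l)" and l: "0 < l"
    and avg: "ennreal (\<omega>) * ennreal (l ^ CARD('n)) \<le> (\<integral>\<^sup>+y\<in>Q. h y \<partial>lebesgue)"
    and \<omega>_nonneg: "0 \<le> \<omega>" and "x \<noteq> 0"
  defines "K \<equiv> ennreal (2 * (11 * real CARD('n)) ^ CARD('n))"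
  shows "ennreal (\<omega> * norm x ^ CARD('n)) \<le> K * (\<integral>\<^sup>+y\<in>cball 0 (norm x). h y \<partial>lebesgue) \<or>
    ennreal (\<omega>) \<le> K * (\<integral>\<^sup>+y. h y / ennreal (norm y ^ CARD('n)) * indicator {y. norm x < norm y} y \<partial>lebesgue)"
proof -
  let ?n = "CARD('n)"
  define \<kappa> where "\<kappa> = (11 * real ?n) ^ ?n"
  have \<kappa>: "0 < \<kappa>" by (simp add: \<kappa>_def)
  note [measurable] = Q(1)
  define I where "I = (\<integral>\<^sup>+y\<in>cball 0 (norm x). h y \<partial>lebesgue)"
  define G where "G = (\<integral>\<^sup>+y. h y / ennreal (norm y ^ ?n) * indicator {y. norm x < norm y} y \<partial>lebesgue)"
  have scale: "r ^ ?n \<le> \<kappa> * l ^ ?n" if "0 \<le> r" "r \<le> 11 * (real ?n * l)" for r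
    using power_mono[OF that(2,1), of ?n] by (simp add: \<kappa>_def power_mult_distrib mult_ac)
  have nx: "0 < norm x ^ ?n" using \<open>x \<noteq> 0\<close> by simp
  have ball_meas [measurable]: "cball 0 (norm x) \<in> sets lebesgue" by simp
  have outer_meas [measurable]: "{y. norm x < norm y} \<in> sets lebesgue"
  proof -
    have "{y \<in> space lebesgue. norm x < norm y} \<in> sets lebesgue" by measurable
    then show ?thesis by simp
  qed
  have "ennreal (\<omega>) * ennreal (l ^ ?n) \<le> (\<integral>\<^sup>+y\<in>Q. h y \<partial>lebesgue)" by (rule avg)
  also have "\<dots> \<le> (\<integral>\<^sup>+y. ennreal (\<kappa> * l ^ ?n) * (1 / ennreal (norm x ^ ?n) * (h y * indicator (cball 0 (norm x)) y)
      + h y / ennreal (norm y ^ ?n) * indicator {y. norm x < norm y} y) \<partial>lebesgue)"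
  proof (intro nn_integral_mono)
    fix y
    have *: "h y \<le> ennreal (\<kappa> * l ^ ?n) * (h y / ennreal (r ^ ?n))" if "0 < r" "r \<le> 11 * (real ?n * l)" for r
    proof -
      have "h y = ennreal (r ^ ?n) * (h y / ennreal (r ^ ?n))"
        using that by (simp add: ennreal_times_divide mult_divide_eq_ennreal mult.commute[of "ennreal (r ^ ?n)"])
      also have "\<dots> \<le> ennreal (\<kappa> * l ^ ?n) * (h y / ennreal (r ^ ?n))"
        using scale[of r] that by (intro mult_right_mono ennreal_leI) auto
      finally show ?thesis .
    qed
    show "h y * indicator Q y \<le> ennreal (\<kappa> * l ^ ?n) * (1 / ennreal (norm x ^ ?n) * (h y * indicator (cball 0 (norm x)) y)
      + h y / ennreal (norm y ^ ?n) * indicator {y. norm x < norm y} y)"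
    proof (cases "y \<in> Q")
      case True
      then have "norm (x - y) \<le> real ?n * l" using Q(2) by (auto simp: dist_norm)
      then have y: "norm y \<le> 11 * (real ?n * l)"
        using norm_triangle_ineq2[of y x] Q(3) by (simp add: norm_minus_commute)
      show ?thesis
      proof (cases "norm x < norm y")
        case True
        then have "0 < norm y" using norm_ge_zero[of x] by linarith
        from *[OF this y] True \<open>y \<in> Q\<close> show ?thesis by simp
      next
        case False
        have "0 < real ?n * l" using l by simp
        then have "norm x \<le> 11 * (real ?n * l)" using Q(3) by linarith
        from *[OF _ this] False \<open>y \<in> Q\<close> \<open>x \<noteq> 0\<close> show ?thesis
          by (simp add: ennreal_divide_times)
      qed
    qed simp
  qed
  also have "\<dots> = ennreal (\<kappa> * l ^ ?n) * (1 / ennreal (norm x ^ ?n) * I + G)"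
    unfolding I_def G_def by (simp add: nn_integral_cmult nn_integral_add)
  also have "\<dots> = ennreal \<kappa> * (I / ennreal (norm x ^ ?n) + G) * ennreal (l ^ ?n)"
  proof -
    have "1 / ennreal (norm x ^ ?n) * I = I / ennreal (norm x ^ ?n)"
      by (simp add: ennreal_times_divide mult.commute[of _ I])
    then show ?thesis using \<kappa> l by (simp add: ennreal_mult mult_ac)
  qed
  finally have "ennreal (l ^ ?n) * ennreal (\<omega>) \<le> ennreal (l ^ ?n) * (ennreal \<kappa> * (I / ennreal (norm x ^ ?n) + G))"
    by (simp add: mult.commute)
  then have le: "ennreal (\<omega>) \<le> ennreal \<kappa> * (I / ennreal (norm x ^ ?n) + G)"
    using l ennreal_mult_le_mult_iff[of "ennreal (l ^ ?n)"] by simp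
  have K: "K * a = ennreal \<kappa> * (a + a)" for a
    using \<kappa> by (simp add: K_def \<kappa>_def ennreal_mult mult_2[symmetric] mult_ac)
  show ?thesis
  proof (cases "I / ennreal (norm x ^ ?n) \<le> G")
    case True
    then have "ennreal \<kappa> * (I / ennreal (norm x ^ ?n) + G) \<le> K * G"
      unfolding K by (intro mult_left_mono add_mono) auto
    then show ?thesis using le unfolding G_def by (meson order_trans)
  next
    case False
    then have "ennreal \<kappa> * (I / ennreal (norm x ^ ?n) + G) \<le> K * (I / ennreal (norm x ^ ?n))"
      unfolding K by (intro mult_left_mono add_mono) auto
    with le have "ennreal (\<omega>) \<le> K * (I / ennreal (norm x ^ ?n))" by (rule order_trans)
    then have "ennreal (\<omega>) * ennreal (norm x ^ ?n) \<le> K * (I / ennreal (norm x ^ ?n)) * ennreal (norm x ^ ?n)"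
      by (rule mult_right_mono) simp
    also have "\<dots> = K * I"
      using \<open>x \<noteq> 0\<close> by (simp add: mult.assoc ennreal_divide_times)
    finally show ?thesis unfolding I_def using nx \<omega>_nonneg by (simp add: ennreal_mult)
  qed
qed

text \<open>Every point of \<open>E\<close> falls under one of the three preceding weak-type estimates.  Truncating to
  \<open>1/m \<le> |x| \<le> m\<close> supplies the bounded radii required by Vitali's lemma and a positive infimum
  of \<open>|x|\<close> for the inner average; the constant does not depend on \<open>m\<close>.\<close>

lemma mixed_weak_type:
  fixes u w :: "real ^ 'n \<Rightarrow> real"
  assumes u [measurable]: "u \<in> borel_measurable lebesgue" and w [measurable]: "w \<in> borel_measurable lebesgue"
    and w_nonneg: "\<And>x. 0 \<le> w x"
    and doubling: "\<And>x y. x \<noteq> 0 \<Longrightarrow> norm x \<le> 2 * norm y \<Longrightarrow> w y \<le> D * w x"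
    and decay: "\<And>x y c. x \<noteq> 0 \<Longrightarrow> 1 \<le> c \<Longrightarrow> c * norm x \<le> norm y \<Longrightarrow> c powr b * w y \<le> w x"
    and D: "0 \<le> D" and b: "real CARD('n) < b"
  shows "\<exists>C>0. \<forall>h E. h \<in> borel_measurable lebesgue \<longrightarrow>
    (\<forall>x\<in>E. x \<noteq> 0 \<and> (\<exists>Q\<in>cubes. x \<in> Q \<and> ennreal (w x) * emeasure lebesgue Q \<le> (\<integral>\<^sup>+y\<in>Q. h y \<partial>lebesgue))) \<longrightarrow>
    weighted_measure (\<lambda>x. u x * w x) E
      \<le> ennreal C * (\<integral>\<^sup>+x. h x * hardy_littlewood_maximal u x \<partial>lebesgue)"
proof -
  let ?n = "CARD('n)" and ?M = "hardy_littlewood_maximal u"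
  define K where "K = 2 * (11 * real ?n) ^ ?n"
  define C\<^sub>1 where "C\<^sub>1 = D * (10 * real ?n) ^ ?n"
  define C\<^sub>2 where "C\<^sub>2 = D * 2 ^ ?n / (1 - 2 powr (real ?n - b))"
  have "2 powr (real ?n - b) < 1" using b by (intro powr_less_one) auto
  then have C12: "0 \<le> C\<^sub>1" "0 \<le> C\<^sub>2" using D by (auto simp: C\<^sub>1_def C\<^sub>2_def)
  have K: "0 < K" by (simp add: K_def)
  define C where "C = C\<^sub>1 + C\<^sub>2 * K + K * 2 ^ ?n"
  have "0 < C" using K C12 by (simp add: C_def add_nonneg_pos)
  moreover have "weighted_measure (\<lambda>x. u x * w x) E \<le> ennreal C * (\<integral>\<^sup>+x. h x * ?M x \<partial>lebesgue)"
    if h [measurable]: "h \<in> borel_measurable lebesgue"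
      and E: "\<And>x. x \<in> E \<Longrightarrow> x \<noteq> 0 \<and> (\<exists>Q\<in>cubes. x \<in> Q \<and> ennreal (w x) * emeasure lebesgue Q \<le> (\<integral>\<^sup>+y\<in>Q. h y \<partial>lebesgue))"
    for h :: "real ^ 'n \<Rightarrow> ennreal" and E :: "(real ^ 'n) set"
  proof -
    let ?I = "\<integral>\<^sup>+x. h x * ?M x \<partial>lebesgue"
    let ?\<mu> = "weighted_measure (\<lambda>x. u x * w x)"
    define G where "G x = (\<integral>\<^sup>+y. h y / ennreal (norm y ^ ?n) * indicator {y. norm x < norm y} y \<partial>lebesgue)"
      for x :: "real ^ 'n"
    define near where "near x \<longleftrightarrow> (\<exists>Q l. Q \<in> sets lebesgue \<and> 0 < l
      \<and> emeasure lebesgue Q = ennreal (l ^ ?n) \<and> Q \<subseteq> cball x (real ?n * l)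
      \<and> 10 * (real ?n * l) \<le> norm x
      \<and> ennreal (w x) * emeasure lebesgue Q \<le> (\<integral>\<^sup>+y\<in>Q. h y \<partial>lebesgue))" for x :: "real ^ 'n"
    define inner where "inner x \<longleftrightarrow>
      ennreal (w x * norm x ^ ?n) \<le> ennreal K * (\<integral>\<^sup>+y\<in>cball 0 (norm x). h y \<partial>lebesgue)" for x :: "real ^ 'n"
    define T\<^sub>3 where "T\<^sub>3 = {x. ennreal (w x) \<le> ennreal K * G x}"
    have split: "near x \<or> inner x \<or> x \<in> T\<^sub>3" if xE: "x \<in> E" for x
    proof -
      obtain Q where Q: "Q \<in> cubes" "x \<in> Q"
        and avg: "ennreal (w x) * emeasure lebesgue Q \<le> (\<integral>\<^sup>+y\<in>Q. h y \<partial>lebesgue)"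
        using E[OF xE] by blast
      obtain l where l: "0 < l" "Q \<in> sets lebesgue" "emeasure lebesgue Q = ennreal (l ^ ?n)"
        and diam: "\<And>x y. x \<in> Q \<Longrightarrow> y \<in> Q \<Longrightarrow> norm (y - x) \<le> real ?n * l"
        using cube_obtain_side[OF Q(1)] by blast
      have sub: "Q \<subseteq> cball x (real ?n * l)"
        using diam Q(2) by (auto simp: dist_norm norm_minus_commute)
      show ?thesis
      proof (cases "10 * (real ?n * l) \<le> norm x")
        case True
        then show ?thesis unfolding near_def using l sub avg by blast
      next
        case False
        have "x \<noteq> 0" using E[OF xE] by blast
        from average_over_large_cube[OF h l(2) sub _ l(1) _ w_nonneg[of x] this] False avg
        show ?thesis by (auto simp: inner_def T\<^sub>3_def G_def K_def l(3))
      qed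
    qed
    have T3: "T\<^sub>3 \<in> sets lebesgue" "?\<mu> T\<^sub>3 \<le> ennreal (K * 2 ^ ?n) * ?I"
      using outer_weak_type[OF u w h w_nonneg G_def, of "ennreal K"] K
      by (simp_all add: T\<^sub>3_def ennreal_mult)
    define Em where "Em m = {x \<in> E. 1 / real (Suc m) \<le> norm x \<and> norm x \<le> real (Suc m)}" for m :: nat
    have "\<exists>T\<in>sets lebesgue. Em m \<subseteq> T \<and> ?\<mu> T \<le> ennreal C * ?I" for m
    proof -
      have "\<exists>T\<in>sets lebesgue. {x \<in> Em m. near x} \<subseteq> T \<and> ?\<mu> T \<le> ennreal C\<^sub>1 * ?I"
        unfolding C\<^sub>1_def
        by (rule local_weak_type[OF u w h w_nonneg D doubling, where R = "real (Suc m)"])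
           (auto simp: Em_def near_def)
      then obtain T\<^sub>1 where T1: "T\<^sub>1 \<in> sets lebesgue" "{x \<in> Em m. near x} \<subseteq> T\<^sub>1" "?\<mu> T\<^sub>1 \<le> ennreal C\<^sub>1 * ?I"
        by blast
      have "\<exists>T\<in>sets lebesgue. {x \<in> Em m. inner x} \<subseteq> T \<and> ?\<mu> T \<le> ennreal (C\<^sub>2 * K) * ?I"
      proof (cases "{x \<in> Em m. inner x} = {}")
        case True
        then show ?thesis by (intro bexI[of _ "{}"]) (auto simp: weighted_measure_def)
      next
        case False
        define s where "s = Inf (norm ` {x \<in> Em m. inner x})"
        have bdd: "bdd_below (norm ` {x \<in> Em m. inner x})" by (intro bdd_belowI[of _ 0]) auto
        have "1 / real (Suc m) \<le> s"
          unfolding s_def using False by (intro cInf_greatest) (auto simp: Em_def)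
        then have "0 < s" by (rule less_le_trans[rotated]) simp
        then have "Inf (norm ` {x \<in> Em m. inner x}) < 2 * s" by (simp add: s_def)
        \<comment> \<open>The infimum of \<open>|x|\<close> need not be attained; a point within a factor 2 of it suffices, as \<open>inner_weak_type\<close> bounds the region outside half its radius.\<close>
        then obtain x0 where x0: "x0 \<in> Em m" "inner x0" "norm x0 < 2 * s"
          using False by (subst (asm) cInf_less_iff[OF _ bdd]) auto
        have "x0 \<noteq> 0" using x0(1) E by (auto simp: Em_def)
        let ?T = "{x :: real ^ 'n. norm x0 \<le> 2 * norm x}"
        have "{x \<in> Em m. inner x} \<subseteq> ?T"
        proof
          fix x assume "x \<in> {x \<in> Em m. inner x}"
          then have "s \<le> norm x" unfolding s_def using bdd by (intro cInf_lower) auto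
          then show "x \<in> ?T" using x0(3) by simp
        qed
        moreover have "?T \<in> sets lebesgue"
        proof -
          have "{x \<in> space lebesgue. norm x0 \<le> 2 * norm (x :: real ^ 'n)} \<in> sets lebesgue" by measurable
          then show ?thesis by simp
        qed
        moreover have "?\<mu> ?T \<le> ennreal (C\<^sub>2 * K) * ?I"
        proof -
          have eq: "ennreal (C\<^sub>2 * K) = ennreal C\<^sub>2 * ennreal K"
            using C12 K by (simp add: ennreal_mult)
          show ?thesis
            unfolding eq unfolding C\<^sub>2_def
            by (rule inner_weak_type[OF u w h w_nonneg D _ _ b \<open>x0 \<noteq> 0\<close> x0(2)[unfolded inner_def]])
               (fact doubling, fact decay)
        qed
        ultimately show ?thesis by blast
      qed
      then obtain T\<^sub>2 where T2: "T\<^sub>2 \<in> sets lebesgue" "{x \<in> Em m. inner x} \<subseteq> T\<^sub>2" "?\<mu> T\<^sub>2 \<le> ennreal (C\<^sub>2 * K) * ?I"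
        by blast
      have uw: "(\<lambda>x. u x * w x) \<in> borel_measurable lebesgue" by measurable
      have "?\<mu> (T\<^sub>1 \<union> T\<^sub>2 \<union> T\<^sub>3) \<le> ?\<mu> T\<^sub>1 + ?\<mu> T\<^sub>2 + ?\<mu> T\<^sub>3"
        using weighted_measure_Un_le[OF uw T1(1) T2(1)] weighted_measure_Un_le[OF uw sets.Un[OF T1(1) T2(1)] T3(1)]
        by (meson add_right_mono order_trans)
      also have "\<dots> \<le> ennreal C\<^sub>1 * ?I + ennreal (C\<^sub>2 * K) * ?I + ennreal (K * 2 ^ ?n) * ?I"
        by (intro add_mono T1 T2 T3)
      also have "\<dots> = ennreal C * ?I"
        using C12 K by (simp add: C_def distrib_right)
      finally have "?\<mu> (T\<^sub>1 \<union> T\<^sub>2 \<union> T\<^sub>3) \<le> ennreal C * ?I" .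
      moreover have "Em m \<subseteq> T\<^sub>1 \<union> T\<^sub>2 \<union> T\<^sub>3"
      proof
        fix x assume x: "x \<in> Em m"
        then have "x \<in> E" by (simp add: Em_def)
        from split[OF this] x show "x \<in> T\<^sub>1 \<union> T\<^sub>2 \<union> T\<^sub>3" using T1(2) T2(2) by blast
      qed
      ultimately show ?thesis using T1(1) T2(1) T3(1) by blast
    qed
    moreover have "incseq Em"
    proof (intro incseq_SucI subsetI)
      fix m x assume "x \<in> Em m"
      moreover have "1 / real (Suc (Suc m)) \<le> 1 / real (Suc m)" by (intro divide_left_mono) auto
      ultimately show "x \<in> Em (Suc m)" by (auto simp: Em_def)
    qed
    moreover have "E \<subseteq> (\<Union>m. Em m)"
    proof
      fix x assume "x \<in> E"
      then have "0 < norm x" using E by simp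
      obtain m where m: "max (norm x) (1 / norm x) \<le> real m" using real_arch_simple by blast
      have "1 / norm x \<le> real (Suc m)" using m by simp
      then have "1 / real (Suc m) \<le> norm x" using \<open>0 < norm x\<close> by (simp add: field_simps)
      moreover have "norm x \<le> real (Suc m)" using m by simp
      ultimately show "x \<in> (\<Union>m. Em m)" using \<open>x \<in> E\<close> by (auto simp: Em_def)
    qed
    ultimately show ?thesis
      by (intro weighted_measure_le_if_exhausted[where E = Em]) auto
  qed
  ultimately show ?thesis by blast
qed

section \<open>The power-logarithmic Young function\<close>

definition power_log :: "real \<Rightarrow> real \<Rightarrow> real \<Rightarrow> real" where
  "power_log r \<delta> t = t powr r * (1 + log_plus t) powr \<delta>"

lemma log_plus_nonneg: "0 \<le> log_plus t"
  by (simp add: log_plus_def)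

lemma log_plus_mono: "0 < s \<Longrightarrow> s \<le> t \<Longrightarrow> log_plus s \<le> log_plus t"
  unfolding log_plus_def by (intro max.mono) auto

lemma one_plus_log_plus_mult_le:
  assumes "0 < s" "0 < t"
  shows "1 + log_plus (s * t) \<le> (1 + log_plus s) * (1 + log_plus t)"
proof -
  have "ln (s * t) = ln s + ln t" using assms by (simp add: ln_mult)
  then have "log_plus (s * t) \<le> log_plus s + log_plus t"
    unfolding log_plus_def by linarith
  then show ?thesis
    using mult_nonneg_nonneg[OF log_plus_nonneg[of s] log_plus_nonneg[of t]]
    by (simp add: algebra_simps)
qed

lemma power_log_0 [simp]: "power_log r \<delta> 0 = 0"
  by (simp add: power_log_def)

lemma power_log_nonneg: "0 \<le> power_log r \<delta> t"
  by (simp add: power_log_def)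

lemma power_log_pos: "0 < t \<Longrightarrow> 0 < power_log r \<delta> t"
  using log_plus_nonneg[of t] by (auto simp: power_log_def intro!: mult_pos_pos)

lemma power_log_measurable [measurable]: "power_log r \<delta> \<in> borel_measurable borel"
  unfolding power_log_def[abs_def] log_plus_def by measurable

text \<open>The logarithmic factor is submultiplicative because \<open>log\<^sup>+(st) \<le> log\<^sup>+ s + log\<^sup>+ t\<close>.\<close>

lemma power_log_submultiplicative:
  assumes "0 \<le> \<delta>" "0 \<le> s" "0 \<le> t"
  shows "power_log r \<delta> (s * t) \<le> power_log r \<delta> s * power_log r \<delta> t"
proof (cases "s = 0 \<or> t = 0")
  case False
  then have st: "0 < s" "0 < t" using assms by auto
  have le: "(1 + log_plus (s * t)) powr \<delta> \<le> ((1 + log_plus s) * (1 + log_plus t)) powr \<delta>"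
    using one_plus_log_plus_mult_le[OF st] log_plus_nonneg[of "s * t"] assms(1) by (intro powr_mono2) auto
  then show ?thesis
    using mult_left_mono[OF le, of "s powr r * t powr r"]
    by (simp add: power_log_def powr_mult mult_ac)
qed auto

lemma power_log_mult_ge:
  assumes "1 \<le> r" "0 \<le> \<delta>" "1 \<le> c" "0 \<le> t"
  shows "c * power_log r \<delta> t \<le> power_log r \<delta> (c * t)"
proof (cases "t = 0")
  case False
  then have t: "0 < t" using assms by simp
  have "1 * t \<le> c * t" using assms t by (intro mult_right_mono) auto
  then have "(1 + log_plus t) powr \<delta> \<le> (1 + log_plus (c * t)) powr \<delta>"
    using log_plus_mono[OF t, of "c * t"] log_plus_nonneg[of t] assms by (intro powr_mono2) auto
  moreover have "c \<le> c powr r" using powr_mono[of 1 r c] assms by simp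
  ultimately have le: "c * (1 + log_plus t) powr \<delta> \<le> c powr r * (1 + log_plus (c * t)) powr \<delta>"
    using assms by (intro mult_mono) auto
  then show ?thesis
    using mult_left_mono[OF le, of "t powr r"] by (simp add: power_log_def powr_mult mult_ac)
qed simp

lemma power_log_mono:
  assumes "0 \<le> r" "0 \<le> \<delta>" "0 \<le> s" "s \<le> t"
  shows "power_log r \<delta> s \<le> power_log r \<delta> t"
proof (cases "s = 0")
  case False
  then have s: "0 < s" using assms by simp
  then show ?thesis
    unfolding power_log_def
    using log_plus_mono[OF s assms(4)] log_plus_nonneg[of s] assms
    by (intro mult_mono powr_mono2) auto
qed (simp add: power_log_nonneg)

text \<open>The next two lemmas are the two properties of \<open>w(x) = 1/\<Phi>(|x|\<^sup>b)\<close> used in the mixed weak-type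
  inequality, as statements about the radii \<open>p\<close> and \<open>q\<close>.  Doubling comes from submultiplicativity of \<open>\<Phi>\<close>.\<close>

lemma inverse_power_log_doubling:
  assumes "0 \<le> r" "0 \<le> \<delta>" "0 \<le> b" "0 < p" "p \<le> 2 * q"
  shows "1 / power_log r \<delta> (q powr b) \<le> power_log r \<delta> (2 powr b) * (1 / power_log r \<delta> (p powr b))"
proof -
  have "0 < q" using assms by simp
  have "power_log r \<delta> (p powr b) \<le> power_log r \<delta> (2 powr b * q powr b)"
    using powr_mono2[of b p "2 * q"] assms by (intro power_log_mono) (auto simp: powr_mult)
  also have "\<dots> \<le> power_log r \<delta> (2 powr b) * power_log r \<delta> (q powr b)"
    using assms by (intro power_log_submultiplicative) auto
  finally have "power_log r \<delta> (p powr b) \<le> power_log r \<delta> (2 powr b) * power_log r \<delta> (q powr b)" .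
  moreover have "0 < power_log r \<delta> (p powr b)" "0 < power_log r \<delta> (q powr b)"
    using assms \<open>0 < q\<close> by (auto intro!: power_log_pos)
  ultimately show ?thesis by (simp add: field_simps)
qed

text \<open>The decay comes from \<open>c \<Phi>(s) \<le> \<Phi>(cs)\<close> for \<open>c \<ge> 1\<close>, which is where \<open>r \<ge> 1\<close> enters.\<close>

lemma inverse_power_log_decay:
  assumes "1 \<le> r" "0 \<le> \<delta>" "0 \<le> b" "0 < p" "1 \<le> c" "c * p \<le> q"
  shows "c powr b * (1 / power_log r \<delta> (q powr b)) \<le> 1 / power_log r \<delta> (p powr b)"
proof -
  have "0 < c * p" using assms by simp
  then have "0 < q" using assms by linarith
  have "c powr b * power_log r \<delta> (p powr b) \<le> power_log r \<delta> (c powr b * p powr b)"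
    using assms by (intro power_log_mult_ge) (auto simp: ge_one_powr_ge_zero)
  also have "\<dots> \<le> power_log r \<delta> (q powr b)"
    using powr_mono2[of b "c * p" q] assms by (intro power_log_mono) (auto simp: powr_mult)
  finally have "c powr b * power_log r \<delta> (p powr b) \<le> power_log r \<delta> (q powr b)" .
  moreover have "0 < power_log r \<delta> (p powr b)" "0 < power_log r \<delta> (q powr b)"
    using assms \<open>0 < q\<close> by (auto intro!: power_log_pos)
  ultimately show ?thesis by (simp add: field_simps)
qed

section \<open>From the Orlicz maximal operator to averages\<close>

text \<open>If the Luxemburg average over \<open>Q\<close> exceeds \<open>t v(x)\<close>, then \<open>t v(x)\<close> is not admissible in its definition,
  so the mean of \<open>\<Phi>(|f v| / (t v(x)))\<close> over \<open>Q\<close> exceeds 1; submultiplicativity splits off the factor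
  \<open>\<Phi>(1/v(x))\<close>.\<close>

lemma orlicz_maximal_gt_imp_large_average:
  fixes f v :: "real ^ 'n \<Rightarrow> real"
  assumes "0 \<le> \<delta>" and "0 < t" and v_nonneg: "\<And>y. 0 \<le> v y" and vx: "0 < v x"
    and [measurable]: "f \<in> borel_measurable lebesgue" "v \<in> borel_measurable lebesgue"
    and gt: "ennreal t < orlicz_maximal (power_log r \<delta>) (\<lambda>y. f y * v y) x / ennreal (v x)"
  shows "\<exists>Q\<in>cubes. x \<in> Q \<and> ennreal (1 / power_log r \<delta> (1 / v x)) * emeasure lebesgue Q
    \<le> (\<integral>\<^sup>+y\<in>Q. ennreal (power_log r \<delta> (\<bar>f y\<bar> * v y / t)) \<partial>lebesgue)"
proof -
  let ?\<Phi> = "power_log r \<delta>"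
  have "ennreal (t * v x) < orlicz_maximal ?\<Phi> (\<lambda>y. f y * v y) x"
  proof (rule ccontr)
    assume "\<not> ?thesis"
    then have "orlicz_maximal ?\<Phi> (\<lambda>y. f y * v y) x / ennreal (v x) \<le> ennreal t"
      using vx \<open>0 < t\<close> by (intro divide_le_posI_ennreal) (auto simp: ennreal_mult not_less mult.commute)
    with gt show False by simp
  qed
  then obtain Q where Q: "Q \<in> cubes" "x \<in> Q"
    and lux: "ennreal (t * v x) < luxemburg_average ?\<Phi> Q (\<lambda>y. f y * v y)"
    unfolding orlicz_maximal_def less_SUP_iff by blast
  obtain l where l: "0 < l" "Q \<in> sets lebesgue" "emeasure lebesgue Q = ennreal (l ^ CARD('n))"
    by (rule cube_obtain_side[OF Q(1)]) (rule that, assumption+)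
  note [measurable] = l(2)
  let ?J = "\<integral>\<^sup>+y\<in>Q. ennreal (?\<Phi> (\<bar>f y * v y\<bar> / (t * v x))) \<partial>lebesgue"
  have tv: "0 < t * v x" using vx \<open>0 < t\<close> by simp
  have not_admissible: "\<not> ?J / emeasure lebesgue Q \<le> 1"
  proof
    assume "?J / emeasure lebesgue Q \<le> 1"
    with tv have "luxemburg_average ?\<Phi> Q (\<lambda>y. f y * v y) \<le> ennreal (t * v x)"
      unfolding luxemburg_average_def by (intro Inf_lower) blast
    with lux show False by simp
  qed
  have Q_pos: "0 < emeasure lebesgue Q" unfolding l(3) using l(1) by simp
  have "\<not> ?J \<le> emeasure lebesgue Q * 1"
  proof
    assume "?J \<le> emeasure lebesgue Q * 1"
    from divide_le_posI_ennreal[OF Q_pos this] not_admissible show False by contradiction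
  qed
  then have "emeasure lebesgue Q \<le> ?J" by simp
  also have "?J \<le> (\<integral>\<^sup>+y. ennreal (?\<Phi> (1 / v x)) * (ennreal (?\<Phi> (\<bar>f y\<bar> * v y / t)) * indicator Q y) \<partial>lebesgue)"
  proof (intro nn_integral_mono)
    fix y
    have "\<bar>f y * v y\<bar> / (t * v x) = (1 / v x) * (\<bar>f y\<bar> * v y / t)"
      using v_nonneg[of y] by (simp add: abs_mult)
    then have "?\<Phi> (\<bar>f y * v y\<bar> / (t * v x)) \<le> ?\<Phi> (1 / v x) * ?\<Phi> (\<bar>f y\<bar> * v y / t)"
      using power_log_submultiplicative[of \<delta> "1 / v x" "\<bar>f y\<bar> * v y / t" r]
        assms(1,2) vx v_nonneg[of y] by simp
    then show "ennreal (?\<Phi> (\<bar>f y * v y\<bar> / (t * v x))) * indicator Q y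
        \<le> ennreal (?\<Phi> (1 / v x)) * (ennreal (?\<Phi> (\<bar>f y\<bar> * v y / t)) * indicator Q y)"
      by (auto simp: ennreal_mult[symmetric] power_log_nonneg intro!: ennreal_leI split: split_indicator)
  qed
  also have "\<dots> = ennreal (?\<Phi> (1 / v x)) * (\<integral>\<^sup>+y\<in>Q. ennreal (?\<Phi> (\<bar>f y\<bar> * v y / t)) \<partial>lebesgue)"
    by (rule nn_integral_cmult) measurable
  finally have "ennreal (1 / ?\<Phi> (1 / v x)) * emeasure lebesgue Q
      \<le> ennreal (1 / ?\<Phi> (1 / v x)) * (ennreal (?\<Phi> (1 / v x)) * (\<integral>\<^sup>+y\<in>Q. ennreal (?\<Phi> (\<bar>f y\<bar> * v y / t)) \<partial>lebesgue))"
    by (rule mult_left_mono) simp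
  also have "\<dots> = (\<integral>\<^sup>+y\<in>Q. ennreal (?\<Phi> (\<bar>f y\<bar> * v y / t)) \<partial>lebesgue)"
  proof -
    have pos: "0 < ?\<Phi> (1 / v x)" using vx by (intro power_log_pos) simp
    then have "ennreal (1 / ?\<Phi> (1 / v x)) * ennreal (?\<Phi> (1 / v x)) = 1"
      by (subst ennreal_mult[symmetric]) auto
    then show ?thesis by (simp add: mult.assoc[symmetric])
  qed
  finally show ?thesis using Q by blast
qed

lemma weight_measurable:
  fixes u :: "real ^ 'n \<Rightarrow> real"
  assumes "weight u"
  shows "u \<in> borel_measurable lebesgue"
proof (rule borel_measurable_LIMSEQ_real)
  show "(\<lambda>x. indicator (cball 0 (real k)) x *\<^sub>R u x) \<in> borel_measurable lebesgue" for k
    using assms compact_cball[of 0 "real k"] unfolding weight_def set_integrable_def by blast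
  show "(\<lambda>k. indicator (cball 0 (real k)) x *\<^sub>R u x) \<longlonglongrightarrow> u x" for x
  proof (rule tendsto_eventually)
    obtain m where "norm x \<le> real m" using real_arch_simple by blast
    then show "\<forall>\<^sub>F k in sequentially. indicator (cball 0 (real k)) x *\<^sub>R u x = u x"
      by (intro eventually_sequentiallyI[of m]) (auto simp: indicator_def)
  qed
qed

theorem theorem3:
  fixes u v w :: "real ^ 'n \<Rightarrow> real" and \<Phi> :: "real \<Rightarrow> real" and \<beta> r \<delta> :: real
  assumes "weight u"
    and "\<beta> < - real CARD('n)"
    and "v = (\<lambda>x. norm x powr \<beta>)"
    and "r \<ge> 1" and "\<delta> \<ge> 0"
    and "\<Phi> = (\<lambda>t. t powr r * (1 + log_plus t) powr \<delta>)"
    and "w = (\<lambda>x. 1 / \<Phi> (1 / v x))"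
  shows "\<exists>C::real. C > 0 \<and>
    (\<forall>t::real. \<forall>f::real ^ 'n \<Rightarrow> real. t > 0 \<longrightarrow> f \<in> borel_measurable lebesgue \<longrightarrow>
       weighted_measure (\<lambda>x. u x * w x)
         {x. orlicz_maximal \<Phi> (\<lambda>y. f y * v y) x / ennreal (v x) > ennreal t}
       \<le> ennreal C *
         (\<integral>\<^sup>+x. ennreal (\<Phi> (\<bar>f x\<bar> * v x / t)) * hardy_littlewood_maximal u x \<partial>lebesgue))"
proof -
  have \<Phi>: "\<Phi> = power_log r \<delta>" using assms(6) by (simp add: power_log_def[abs_def])
  define b where "b = - \<beta>"
  have b: "real CARD('n) < b" "0 \<le> b" using assms(2) by (auto simp: b_def)
  have "1 / v x = norm x powr b" for x
    by (simp add: assms(3) b_def powr_minus_divide)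
  then have w: "w x = 1 / power_log r \<delta> (norm x powr b)" for x by (simp add: assms(7) \<Phi>)
  have v_meas [measurable]: "v \<in> borel_measurable lebesgue" unfolding assms(3) by measurable
  have w_meas: "w \<in> borel_measurable lebesgue" unfolding w[abs_def] by measurable
  have w_nonneg: "0 \<le> w x" for x by (simp add: w power_log_nonneg)
  have doubling: "w y \<le> power_log r \<delta> (2 powr b) * w x" if "x \<noteq> 0" "norm x \<le> 2 * norm y" for x y
    unfolding w using that assms(4,5) b by (intro inverse_power_log_doubling) auto
  have decay: "c powr b * w y \<le> w x" if "x \<noteq> 0" "1 \<le> c" "c * norm x \<le> norm y" for x y c
    unfolding w using that assms(4,5) b by (intro inverse_power_log_decay) auto
  obtain C where C: "0 < C" "\<And>h E. h \<in> borel_measurable lebesgue \<Longrightarrow>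
    (\<And>x. x \<in> E \<Longrightarrow> x \<noteq> 0 \<and> (\<exists>Q\<in>cubes. x \<in> Q \<and> ennreal (w x) * emeasure lebesgue Q \<le> (\<integral>\<^sup>+y\<in>Q. h y \<partial>lebesgue))) \<Longrightarrow>
    weighted_measure (\<lambda>x. u x * w x) E
      \<le> ennreal C * (\<integral>\<^sup>+x. h x * hardy_littlewood_maximal u x \<partial>lebesgue)"
    using mixed_weak_type[OF weight_measurable[OF assms(1)] w_meas w_nonneg doubling decay power_log_nonneg b(1)]
    by blast
  have "weighted_measure (\<lambda>x. u x * w x) {x. ennreal t < orlicz_maximal \<Phi> (\<lambda>y. f y * v y) x / ennreal (v x)}
      \<le> ennreal C * (\<integral>\<^sup>+x. ennreal (\<Phi> (\<bar>f x\<bar> * v x / t)) * hardy_littlewood_maximal u x \<partial>lebesgue)"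
    (is "weighted_measure ?\<rho> ?S \<le> _")
    if "0 < t" and f [measurable]: "f \<in> borel_measurable lebesgue" for t and f :: "real ^ 'n \<Rightarrow> real"
  proof -
    \<comment> \<open>By the conventions \<open>0 powr b = 0\<close> and \<open>1/0 = 0\<close>, the origin carries no mass although \<open>v\<close> vanishes there.\<close>
    have "w 0 = 0" by (simp add: w)
    then have "weighted_measure ?\<rho> ?S = weighted_measure ?\<rho> (?S - {0})"
      unfolding weighted_measure_def by (intro nn_integral_cong) (auto split: split_indicator)
    also have "\<dots> \<le> ennreal C * (\<integral>\<^sup>+x. ennreal (\<Phi> (\<bar>f x\<bar> * v x / t)) * hardy_littlewood_maximal u x \<partial>lebesgue)"
    proof (rule C(2))
      show "(\<lambda>x. ennreal (\<Phi> (\<bar>f x\<bar> * v x / t))) \<in> borel_measurable lebesgue"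
        unfolding \<Phi> by measurable
    next
      fix x assume x: "x \<in> ?S - {0}"
      then have "0 < v x" by (simp add: assms(3))
      moreover have "ennreal t < orlicz_maximal (power_log r \<delta>) (\<lambda>y. f y * v y) x / ennreal (v x)"
        using x by (simp add: \<Phi>)
      moreover have "0 \<le> v y" for y by (simp add: assms(3))
      ultimately show "x \<noteq> 0 \<and> (\<exists>Q\<in>cubes. x \<in> Q \<and> ennreal (w x) * emeasure lebesgue Q
          \<le> (\<integral>\<^sup>+y\<in>Q. ennreal (\<Phi> (\<bar>f y\<bar> * v y / t)) \<partial>lebesgue))"
        using orlicz_maximal_gt_imp_large_average[OF assms(5) \<open>0 < t\<close> _ _ f v_meas, of x r] x
        by (simp add: \<Phi> assms(7))
    qed
    finally show ?thesis .
  qed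
  with C(1) show ?thesis by blast
qed

end
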